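(* Let $\mathcal{H}\subseteq\mathcal{K}$ be complex Hilbert spaces, let $T\in\mathcal{B}(\mathcal{H})$ be a contraction and let $W\in\mathcal{B}(\mathcal{K})$ be a co-isometric extension of $T$. Let $X\in\mathcal{B}(\mathcal{H})$. Let $Q\in\mathcal{B}(\mathcal{H})$ and $\overline{Q}\in\mathcal{B}(\mathcal{K})$ be contractions such that $\mathcal{H}$ reduces $\overline{Q}$ and $\overline{Q}|_{\mathcal{H}}=Q$. (i) If $XTQ=TX$, then there exists an extension $Y\in\mathcal{B}(\mathcal{K})$ of $X$ such that $YW\overline{Q}=WY$. (ii) If $XQT=TX$, then there exists an extension $Y\in\mathcal{B}(\mathcal{K})$ of $X$ such that $Y\overline{Q}W=WY$. (iii) If moreover $Q$ and $\overline{Q}$ are unitary and $QXT=TX$, then there exists an extension $Y\in\mathcal{B}(\mathcal{K})$ of $X$ such that $\overline{Q}YW=WY$. In all cases $T^nX^m=P_{\mathcal{H}}W^nY^m|_{\mathcal{H}}$ and $X^nT^m=P_{\mathcal{H}}Y^nW^m|_{\mathcal{H}}$ for all integers $n,m\geq 0$, and $Y$ can be chosen such that $\|Y\|=\|X\|$.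
   Context: For Hilbert spaces $\mathcal{H}\subseteq\mathcal{K}$, $S\in\mathcal{B}(\mathcal{K})$ is an extension of $T\in\mathcal{B}(\mathcal{H})$ if $S h=Th$ for all $h\in\mathcal{H}$; a co-isometric extension is an extension $W$ with $WW^*=I$. $P_{\mathcal{H}}$ is the orthogonal projection onto $\mathcal{H}$. *)

theory Defs
  imports "HOL-Analysis.Analysis"
begin

text \<open>A complex Hilbert space, encoded as a real Hilbert space together with the
  operator of multiplication by the imaginary unit (an orthogonal complex structure).
  Complex scalar multiplication and the complex inner product are derived from it.\<close>

class complex_hilbert = real_inner + complete_space +
  fixes imult :: "'a \<Rightarrow> 'a"
  assumes imult_add: "imult (x + y) = imult x + imult y"
    and imult_scaleR: "imult (r *\<^sub>R x) = r *\<^sub>R imult x"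
    and imult_imult: "imult (imult x) = - x"
    and inner_imult: "inner (imult x) (imult y) = inner x y"

definition scaleC :: "complex \<Rightarrow> 'a::complex_hilbert \<Rightarrow> 'a" (infixr "*\<^sub>C" 75) where
  "c *\<^sub>C x = Re c *\<^sub>R x + Im c *\<^sub>R imult x"

text \<open>Complex inner product, conjugate-linear in the first and linear in the second argument.\<close>
definition cinner :: "'a::complex_hilbert \<Rightarrow> 'a \<Rightarrow> complex" where
  "cinner x y = Complex (inner x y) (- inner x (imult y))"

definition csubspace :: "'a::complex_hilbert set \<Rightarrow> bool" where
  "csubspace H \<longleftrightarrow> 0 \<in> H \<and> (\<forall>x\<in>H. \<forall>y\<in>H. x + y \<in> H) \<and> (\<forall>c. \<forall>x\<in>H. c *\<^sub>C x \<in> H)"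

definition hilbert_subspace :: "'a::complex_hilbert set \<Rightarrow> bool" where
  "hilbert_subspace H \<longleftrightarrow> csubspace H \<and> closed H"

text \<open>A bounded complex-linear operator on the subspace H (only its values on H matter).\<close>
definition bounded_op_on :: "'a::complex_hilbert set \<Rightarrow> ('a \<Rightarrow> 'a) \<Rightarrow> bool" where
  "bounded_op_on H A \<longleftrightarrow>
     (\<forall>x\<in>H. A x \<in> H) \<and>
     (\<forall>x\<in>H. \<forall>y\<in>H. A (x + y) = A x + A y) \<and>
     (\<forall>c. \<forall>x\<in>H. A (c *\<^sub>C x) = c *\<^sub>C A x) \<and>
     (\<exists>C. \<forall>x\<in>H. norm (A x) \<le> C * norm x)"

definition opnorm_on :: "'a::complex_hilbert set \<Rightarrow> ('a \<Rightarrow> 'a) \<Rightarrow> real" where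
  "opnorm_on H A = Sup ((\<lambda>x. norm (A x)) ` {x\<in>H. norm x \<le> 1})"

definition contraction_on :: "'a::complex_hilbert set \<Rightarrow> ('a \<Rightarrow> 'a) \<Rightarrow> bool" where
  "contraction_on H A \<longleftrightarrow> bounded_op_on H A \<and> (\<forall>x\<in>H. norm (A x) \<le> norm x)"

definition unitary_on :: "'a::complex_hilbert set \<Rightarrow> ('a \<Rightarrow> 'a) \<Rightarrow> bool" where
  "unitary_on H A \<longleftrightarrow> bounded_op_on H A \<and> A ` H = H \<and>
     (\<forall>x\<in>H. \<forall>y\<in>H. cinner (A x) (A y) = cinner x y)"

definition coisometry :: "('a::complex_hilbert \<Rightarrow> 'a) \<Rightarrow> bool" where
  "coisometry W \<longleftrightarrow> (\<exists>Ws. bounded_op_on UNIV Ws \<and>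
      (\<forall>x y. cinner (W x) y = cinner x (Ws y)) \<and> (\<forall>x. W (Ws x) = x))"

definition orth_compl :: "'a::complex_hilbert set \<Rightarrow> 'a set" where
  "orth_compl H = {y. \<forall>h\<in>H. cinner h y = 0}"

definition reduces :: "'a::complex_hilbert set \<Rightarrow> ('a \<Rightarrow> 'a) \<Rightarrow> bool" where
  "reduces H A \<longleftrightarrow> (\<forall>x\<in>H. A x \<in> H) \<and> (\<forall>x\<in>orth_compl H. A x \<in> orth_compl H)"

definition proj :: "'a::complex_hilbert set \<Rightarrow> 'a \<Rightarrow> 'a" where
  "proj H x = (SOME p. p \<in> H \<and> x - p \<in> orth_compl H)"

definition extends_on :: "'a::complex_hilbert set \<Rightarrow> ('a \<Rightarrow> 'a) \<Rightarrow> ('a \<Rightarrow> 'a) \<Rightarrow> bool" where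
  "extends_on H S A \<longleftrightarrow> (\<forall>h\<in>H. S h = A h)"

end

theory Submission
  imports Defs
begin

text \<open>All three parts are instances of one statement: if \<open>A\<close> is a contraction leaving \<open>H\<close> invariant,
  \<open>W\<close> is a coisometry and \<open>X A = W X\<close> on \<open>H\<close>, then \<open>X\<close> extends to \<open>Y\<close> with \<open>Y A = W Y\<close> and the same
  norm. Take \<open>A = W Qb\<close> in (i), \<open>A = Qb W\<close> in (ii), and \<open>A = W\<close> with the coisometry \<open>Qb\<^sup>* W\<close> in (iii).

  No dilation space is needed. Given any extension \<open>Y\<^sub>n\<close> of \<open>X\<close> with norm at most \<open>c = \<parallel>X\<parallel>\<close>, an
  extension \<open>Y'\<close> with \<open>W Y' = Y\<^sub>n A\<close> and norm at most \<open>c\<close> has the form \<open>W\<^sup>* Y\<^sub>n A + Z\<close> with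
  \<open>Z\<close> mapping into \<open>ker W\<close>, prescribed on \<open>H\<close> and dominated by the semi-inner product
  \<open>c\<^sup>2 \<langle>x, y\<rangle> - \<langle>Y\<^sub>n A x, Y\<^sub>n A y\<rangle>\<close>; it is obtained by projecting onto \<open>H\<close> with respect to that
  form. Iterating and taking a weak cluster point of the Cesaro means yields \<open>Y\<close>. The argument runs
  over the reals; complex linearity is restored by averaging at the end.\<close>

section \<open>Extension of operators dominated by a semi-inner product\<close>

locale semi_inner =
  fixes g :: "'a::real_vector \<Rightarrow> 'a \<Rightarrow> real"
  assumes add: "g (x + y) z = g x z + g y z"
    and scale: "g (r *\<^sub>R x) z = r * g x z"
    and sym: "g x y = g y x"
    and pos: "g x x \<ge> 0"
begin

section \<open>Bilinear calculus and the Cauchy-Schwarz inequality for a possibly degenerate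
  form\<close>

lemma add_right: "g z (x + y) = g z x + g z y"
  by (metis add sym)

lemma scale_right: "g z (r *\<^sub>R x) = r * g z x"
  by (metis scale sym)

lemma diff: "g (x - y) z = g x z - g y z"
  using add[of x "(-1) *\<^sub>R y" z] scale[of "-1" y z] by simp

lemma diff_right: "g z (x - y) = g z x - g z y"
  by (metis diff sym)

text \<open>Expanding the hypothesis gives a quadratic in \<open>t\<close> that is nonnegative
  everywhere, so its discriminant is at most zero. Since \<open>g s s\<close> may vanish for nonzero
  \<open>s\<close>, the linear case is treated separately.\<close>

lemma abs_le_of_almost_minimal:
  assumes e: "e \<ge> 0" and min: "\<And>t. g (u - t *\<^sub>R s) (u - t *\<^sub>R s) \<ge> g u u - e\<^sup>2"
  shows "\<bar>g u s\<bar> \<le> e * sqrt (g s s)"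
proof -
  have *: "t\<^sup>2 * g s s - 2 * t * g u s + e\<^sup>2 \<ge> 0" for t
    using min[of t] sym[of s u]
    by (simp add: diff diff_right scale scale_right algebra_simps power2_eq_square)
  have "(g u s)\<^sup>2 \<le> e\<^sup>2 * g s s"
  proof (cases "g s s = 0")
    case True
    have "g u s = 0"
    proof (rule ccontr)
      assume "g u s \<noteq> 0"
      \<comment> \<open>This \<open>t\<close> makes the now affine expression equal to -1.\<close>
      with *[of "(e\<^sup>2 + 1) / (2 * g u s)"] True show False by simp
    qed
    then show ?thesis using True by simp
  next
    case False
    with pos[of s] have p: "g s s > 0" by simp
    \<comment> \<open>The minimiser of the quadratic is inserted.\<close>
    from *[of "g u s / g s s"] p have "e\<^sup>2 - (g u s)\<^sup>2 / g s s \<ge> 0"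
      by (simp add: power2_eq_square field_simps)
    with p show ?thesis by (simp add: field_simps)
  qed
  then have "sqrt ((g u s)\<^sup>2) \<le> sqrt (e\<^sup>2 * g s s)" by (rule real_sqrt_le_mono)
  with e show ?thesis by (simp add: real_sqrt_mult)
qed

text \<open>With \<open>e = sqrt (g x x)\<close> the almost-minimality hypothesis is just positivity
  of \<open>g\<close>.\<close>

lemma Cauchy_Schwarz: "\<bar>g x y\<bar> \<le> sqrt (g x x) * sqrt (g y y)"
  by (rule abs_le_of_almost_minimal) (use pos in auto)

text \<open>An exact \<open>g\<close>-orthogonal projection onto \<open>S\<close> may fail to exist,
  as \<open>S\<close> need not be complete for \<open>g\<close>. Instead the residual
  \<open>x - h\<close>, as a functional on \<open>S\<close>, has \<open>g\<close>-norm at most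
  \<open>e\<close>.\<close>

definition almost_proj :: "'a set \<Rightarrow> real \<Rightarrow> 'a \<Rightarrow> 'a \<Rightarrow> bool" where
  "almost_proj S e x h \<longleftrightarrow> h \<in> S \<and> (\<forall>s\<in>S. \<bar>g (x - h) s\<bar> \<le> e * sqrt (g s s))"

text \<open>A point of \<open>S\<close> whose squared \<open>g\<close>-distance to \<open>x\<close>
  is within \<open>e\<^sup>2\<close> of the infimum has an almost orthogonal residual.\<close>

lemma almost_proj_exists:
  assumes S: "subspace S" and e: "e > 0"
  shows "\<exists>h. almost_proj S e x h"
proof -
  let ?D = "(\<lambda>h. g (x - h) (x - h)) ` S"
  have bdd: "bdd_below ?D" using pos by (auto intro: bdd_belowI[of _ 0])
  have ne: "?D \<noteq> {}" using subspace_0[OF S] by auto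
  have "Inf ?D < Inf ?D + e\<^sup>2" using e by simp
  then have "\<exists>y\<in>?D. y < Inf ?D + e\<^sup>2"
    using cInf_less_iff[OF ne bdd] by blast
  then obtain h where h: "h \<in> S" and lt: "g (x - h) (x - h) < Inf ?D + e\<^sup>2"
    by auto
  have "\<bar>g (x - h) s\<bar> \<le> e * sqrt (g s s)" if s: "s \<in> S" for s
  proof (rule abs_le_of_almost_minimal)
    fix t
    have "h + t *\<^sub>R s \<in> S" using S h s by (simp add: subspace_add subspace_scale)
    then have "Inf ?D \<le> g (x - (h + t *\<^sub>R s)) (x - (h + t *\<^sub>R s))"
      by (intro cInf_lower bdd imageI)
    with lt show "g (x - h - t *\<^sub>R s) (x - h - t *\<^sub>R s) \<ge> g (x - h) (x - h) - e\<^sup>2"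
      by (simp add: diff_diff_eq)
  qed (use e in simp)
  with h show ?thesis by (auto simp: almost_proj_def)
qed

lemma sqrt_le_of_self_bound:
  assumes "g x x \<le> a * sqrt (g x x)" and "a \<ge> 0"
  shows "sqrt (g x x) \<le> a"
proof (cases "g x x = 0")
  case False
  with pos[of x] have "sqrt (g x x) > 0" by simp
  moreover have "sqrt (g x x) * sqrt (g x x) \<le> a * sqrt (g x x)" using assms(1) pos[of x] by simp
  ultimately show ?thesis by (rule mult_right_le_imp_le[rotated])
qed (use assms in simp)

lemma almost_proj_add:
  assumes "subspace S" "almost_proj S e x h" "almost_proj S e' y k"
  shows "almost_proj S (e + e') (x + y) (h + k)"
proof -
  have "\<bar>g (x + y - (h + k)) s\<bar> \<le> (e + e') * sqrt (g s s)" if "s \<in> S" for s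
  proof -
    have "g (x + y - (h + k)) s = g (x - h) s + g (y - k) s" by (simp add: diff add)
    moreover have "\<bar>g (x - h) s\<bar> \<le> e * sqrt (g s s)" "\<bar>g (y - k) s\<bar> \<le> e' * sqrt (g s s)"
      using assms that by (auto simp: almost_proj_def)
    ultimately show ?thesis by (simp add: distrib_right)
  qed
  with assms show ?thesis by (simp add: almost_proj_def subspace_add)
qed

lemma almost_proj_scale:
  assumes "subspace S" "almost_proj S e x h"
  shows "almost_proj S (\<bar>r\<bar> * e) (r *\<^sub>R x) (r *\<^sub>R h)"
proof -
  have "\<bar>g (r *\<^sub>R x - r *\<^sub>R h) s\<bar> \<le> \<bar>r\<bar> * e * sqrt (g s s)" if "s \<in> S" for s
  proof -
    have "g (r *\<^sub>R x - r *\<^sub>R h) s = r * g (x - h) s"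
      by (simp flip: scaleR_diff_right add: scale)
    moreover have "\<bar>g (x - h) s\<bar> \<le> e * sqrt (g s s)"
      using assms that by (auto simp: almost_proj_def)
    ultimately show ?thesis by (simp add: abs_mult mult.assoc mult_left_mono)
  qed
  with assms show ?thesis by (simp add: almost_proj_def subspace_scale)
qed

text \<open>The difference \<open>h - k\<close> lies in \<open>S\<close>, so both residuals can be
  tested against it. This replaces uniqueness of the projection and makes sequences of almost
  projections Cauchy.\<close>

lemma almost_proj_dist:
  assumes S: "subspace S" and h: "almost_proj S e x h" "almost_proj S e' x k" and "e \<ge> 0" "e' \<ge> 0"
  shows "sqrt (g (h - k) (h - k)) \<le> e + e'"
proof (rule sqrt_le_of_self_bound)
  have s: "h - k \<in> S" using S h by (auto simp: almost_proj_def subspace_diff)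
  have "g (h - k) (h - k) = g (x - k) (h - k) - g (x - h) (h - k)" by (simp add: diff)
  also have "\<dots> \<le> e' * sqrt (g (h - k) (h - k)) + e * sqrt (g (h - k) (h - k))"
    using h s unfolding almost_proj_def by (smt (verit))
  finally show "g (h - k) (h - k) \<le> (e + e') * sqrt (g (h - k) (h - k))"
    by (simp add: algebra_simps)
qed (use assms in simp)

text \<open>Testing the residual against \<open>h\<close> itself shows that projecting increases the
  \<open>g\<close>-seminorm by at most \<open>e\<close>.\<close>

lemma almost_proj_norm:
  assumes h: "almost_proj S e x h" and "e \<ge> 0"
  shows "sqrt (g h h) \<le> sqrt (g x x) + e"
proof (rule sqrt_le_of_self_bound)
  have "g h h = g x h - g (x - h) h" by (simp add: diff)
  also have "\<dots> \<le> sqrt (g x x) * sqrt (g h h) + e * sqrt (g h h)"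
    using h Cauchy_Schwarz[of x h] unfolding almost_proj_def by (smt (verit))
  finally show "g h h \<le> (sqrt (g x x) + e) * sqrt (g h h)"
    by (simp add: algebra_simps)
qed (use assms pos in simp)

text \<open>\<open>Z\<close> is \<open>Z\<^sub>0\<close> composed with the
  \<open>g\<close>-orthogonal projection onto \<open>S\<close>. No completion is built:
  \<open>Z x\<close> is the limit of \<open>Z\<^sub>0\<close> along almost projections of
  \<open>x\<close>, which exists because \<open>Z\<^sub>0\<close> is Lipschitz for the
  \<open>g\<close>-seminorm. The closure clause later keeps the extension inside a closed
  kernel.\<close>

theorem extend_dominated:
  fixes Z\<^sub>0 :: "'a \<Rightarrow> 'b::banach"
  assumes S: "subspace S"
    and Zadd: "\<And>x y. x \<in> S \<Longrightarrow> y \<in> S \<Longrightarrow> Z\<^sub>0 (x + y) = Z\<^sub>0 x + Z\<^sub>0 y"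
    and Zscale: "\<And>r x. x \<in> S \<Longrightarrow> Z\<^sub>0 (r *\<^sub>R x) = r *\<^sub>R Z\<^sub>0 x"
    and Zbd: "\<And>x. x \<in> S \<Longrightarrow> norm (Z\<^sub>0 x) \<le> sqrt (g x x)"
  shows "\<exists>Z. linear Z \<and> (\<forall>x\<in>S. Z x = Z\<^sub>0 x) \<and> (\<forall>x. norm (Z x) \<le> sqrt (g x x)) \<and>
    (\<forall>x. Z x \<in> closure (Z\<^sub>0 ` S))"
proof -
  define e :: "nat \<Rightarrow> real" where "e n = inverse (real (Suc n))" for n
  have e0: "e n > 0" for n by (simp add: e_def)
  have elim: "e \<longlonglongrightarrow> 0" unfolding e_def by (rule LIMSEQ_inverse_real_of_nat)
  define h where "h x n = (SOME h. almost_proj S (e n) x h)" for x n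
  have h: "almost_proj S (e n) x (h x n)" for x n
    unfolding h_def by (rule someI_ex[OF almost_proj_exists[OF S e0]])
  have hS: "h x n \<in> S" for x n using h by (simp add: almost_proj_def)
  have Zdiff: "Z\<^sub>0 (x - y) = Z\<^sub>0 x - Z\<^sub>0 y" if "x \<in> S" "y \<in> S" for x y
    using Zadd[of x "(-1) *\<^sub>R y"] Zscale[of y "-1"] that S by (simp add: subspace_neg)
  have dist: "norm (Z\<^sub>0 p - Z\<^sub>0 q) \<le> a + b"
    if "almost_proj S a x p" "almost_proj S b x q" "a \<ge> 0" "b \<ge> 0" for a b x p q
  proof -
    have pq: "p \<in> S" "q \<in> S" using that by (auto simp: almost_proj_def)
    have "norm (Z\<^sub>0 p - Z\<^sub>0 q) = norm (Z\<^sub>0 (p - q))" using Zdiff pq by simp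
    also have "\<dots> \<le> sqrt (g (p - q) (p - q))" using Zbd S pq by (simp add: subspace_diff)
    also have "\<dots> \<le> a + b" using almost_proj_dist S that by blast
    finally show ?thesis .
  qed
  have "Cauchy (\<lambda>n. Z\<^sub>0 (h x n))" for x
  proof (rule CauchyI)
    fix \<epsilon> :: real assume "\<epsilon> > 0"
    then obtain N where N: "\<And>n. n \<ge> N \<Longrightarrow> e n < \<epsilon> / 2"
      using order_tendstoD(2)[OF elim, of "\<epsilon> / 2"] by (auto simp: eventually_sequentially)
    show "\<exists>M. \<forall>m\<ge>M. \<forall>n\<ge>M. norm (Z\<^sub>0 (h x m) - Z\<^sub>0 (h x n)) < \<epsilon>"
    proof (intro exI allI impI)
      fix m n assume "m \<ge> N" "n \<ge> N"
      then show "norm (Z\<^sub>0 (h x m) - Z\<^sub>0 (h x n)) < \<epsilon>"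
        using dist[OF h[of m x] h[of n x]] N[of m] N[of n] e0[of m] e0[of n] by linarith
    qed
  qed
  then have "\<exists>z. (\<lambda>n. Z\<^sub>0 (h x n)) \<longlonglongrightarrow> z" for x
    by (simp add: Cauchy_convergent_iff convergent_def)
  then obtain Z where Z: "\<And>x. (\<lambda>n. Z\<^sub>0 (h x n)) \<longlonglongrightarrow> Z x" by metis
  \<comment> \<open>The limit does not depend on the chosen almost projections. Linearity and the
    extension property then follow by exhibiting convenient sequences.\<close>
  have uniq: "Z x = z"
    if p: "\<And>n. almost_proj S (d n) x (p n)" "\<And>n. d n \<ge> 0" "d \<longlonglongrightarrow> 0" "(\<lambda>n. Z\<^sub>0 (p n)) \<longlonglongrightarrow> z" for x z d p
  proof -
    have "(\<lambda>n. Z\<^sub>0 (h x n) - Z\<^sub>0 (p n)) \<longlonglongrightarrow> 0"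
    proof (rule Lim_null_comparison)
      show "\<forall>\<^sub>F n in sequentially. norm (Z\<^sub>0 (h x n) - Z\<^sub>0 (p n)) \<le> e n + d n"
        using dist[OF h p(1)] e0 p(2) by (simp add: less_imp_le)
      show "(\<lambda>n. e n + d n) \<longlonglongrightarrow> 0" using tendsto_add[OF elim p(3)] by simp
    qed
    moreover have "(\<lambda>n. Z\<^sub>0 (h x n) - Z\<^sub>0 (p n)) \<longlonglongrightarrow> Z x - z" by (intro tendsto_diff Z p)
    ultimately show ?thesis using LIMSEQ_unique by fastforce
  qed
  show ?thesis
  proof (intro exI conjI ballI allI)
    show "linear Z"
    proof (rule linearI)
      fix x y
      show "Z (x + y) = Z x + Z y"
      proof (rule uniq)
        show "almost_proj S (e n + e n) (x + y) (h x n + h y n)" for n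
          by (intro almost_proj_add S h)
        show "(\<lambda>n. e n + e n) \<longlonglongrightarrow> 0" using tendsto_add[OF elim elim] by simp
        show "(\<lambda>n. Z\<^sub>0 (h x n + h y n)) \<longlonglongrightarrow> Z x + Z y"
          using tendsto_add[OF Z[of x] Z[of y]] Zadd hS by simp
      qed (use e0 in \<open>simp add: less_imp_le\<close>)
    next
      fix r x
      show "Z (r *\<^sub>R x) = r *\<^sub>R Z x"
      proof (rule uniq)
        show "almost_proj S (\<bar>r\<bar> * e n) (r *\<^sub>R x) (r *\<^sub>R h x n)" for n
          by (intro almost_proj_scale S h)
        show "(\<lambda>n. \<bar>r\<bar> * e n) \<longlonglongrightarrow> 0" using tendsto_mult_left[OF elim, of "\<bar>r\<bar>"] by simp
        show "(\<lambda>n. Z\<^sub>0 (r *\<^sub>R h x n)) \<longlonglongrightarrow> r *\<^sub>R Z x"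
          using tendsto_scaleR[OF tendsto_const Z[of x]] Zscale hS by simp
      qed (use e0 in \<open>simp add: less_imp_le\<close>)
    qed
  next
    fix x assume x: "x \<in> S"
    show "Z x = Z\<^sub>0 x"
    proof (rule uniq)
      \<comment> \<open>A point of \<open>S\<close> is its own projection, with error zero.\<close>
      show "almost_proj S 0 x x" for n :: nat
        using x scale[of 0 x] by (simp add: almost_proj_def diff)
    qed auto
  next
    fix x
    have "norm (Z\<^sub>0 (h x n)) \<le> sqrt (g x x) + e n" for n
      using Zbd[OF hS[of x n]] almost_proj_norm[OF h[of n x]] e0[of n] by linarith
    moreover have "(\<lambda>n. sqrt (g x x) + e n) \<longlonglongrightarrow> sqrt (g x x)"
      using tendsto_add[OF tendsto_const elim] by simp
    ultimately show "norm (Z x) \<le> sqrt (g x x)"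
      using LIMSEQ_le[OF tendsto_norm[OF Z[of x]]] by blast
  next
    fix x
    show "Z x \<in> closure (Z\<^sub>0 ` S)"
      using Z[of x] hS by (auto simp: closure_sequential intro!: exI[of _ "\<lambda>n. Z\<^sub>0 (h x n)"])
  qed
qed

end
section \<open>Riesz representation and weak cluster points\<close>

lemma semi_inner_inner: "semi_inner ((\<bullet>) :: 'a::real_inner \<Rightarrow> 'a \<Rightarrow> real)"
  by unfold_locales (auto simp: inner_add_left inner_add_right inner_commute)

text \<open>Extending the identity of \<open>S\<close> with the inner product as dominating form
  gives a contractive idempotent \<open>P\<close> onto \<open>S\<close>. The kernel of such an
  idempotent, which contains \<open>x - P x\<close>, is orthogonal to its range.\<close>

lemma exists_orthogonal_to_closed_subspace:
  fixes S :: "'a::{real_inner,banach} set"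
  assumes S: "subspace S" "closed S"
  shows "\<exists>p\<in>S. \<forall>s\<in>S. (x - p) \<bullet> s = 0"
proof -
  interpret semi_inner "(\<bullet>) :: 'a \<Rightarrow> 'a \<Rightarrow> real" by (rule semi_inner_inner)
  obtain P where P: "linear P" "\<And>s. s \<in> S \<Longrightarrow> P s = s" "\<And>x. norm (P x) \<le> norm x"
      "\<And>x. P x \<in> S"
    using extend_dominated[OF S(1), of "\<lambda>x. x"] S(2) by (auto simp: norm_eq_sqrt_inner)
  define u where "u = x - P x"
  have 0: "P u = 0" using P by (simp add: u_def linear_diff)
  have "u \<bullet> w = 0" if w: "w \<in> S" for w
  proof (rule ccontr)
    assume ne: "u \<bullet> w \<noteq> 0"
    \<comment> \<open>Contractivity will give
      \<open>0 \<le> 2 * t * (u \<bullet> w) + u \<bullet> u\<close>; this \<open>t\<close> makes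
      the right side -1.\<close>
    define t where "t = - (u \<bullet> u + 1) / (2 * (u \<bullet> w))"
    have "P (t *\<^sub>R w + u) = t *\<^sub>R w"
      using P w 0 by (simp add: linear_add linear_scale)
    then have "norm (t *\<^sub>R w) \<le> norm (t *\<^sub>R w + u)" using P(3) by metis
    then have "(t *\<^sub>R w) \<bullet> (t *\<^sub>R w) \<le> (t *\<^sub>R w + u) \<bullet> (t *\<^sub>R w + u)"
      by (simp only: norm_le)
    then have "0 \<le> 2 * t * (u \<bullet> w) + u \<bullet> u"
      by (simp add: inner_add_left inner_add_right inner_commute algebra_simps)
    moreover have "2 * t * (u \<bullet> w) = - (u \<bullet> u + 1)" using ne by (simp add: t_def)
    ultimately show False by simp
  qed
  with P(4) show ?thesis by (auto simp: u_def)
qed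

lemma Riesz_representation:
  fixes f :: "'a::{real_inner,banach} \<Rightarrow> real"
  assumes f: "bounded_linear f"
  shows "\<exists>z. \<forall>x. f x = z \<bullet> x"
proof (cases "\<forall>x. f x = 0")
  case True
  then show ?thesis by (intro exI[of _ 0]) simp
next
  case False
  interpret f: bounded_linear f by (rule f)
  from False obtain x where x: "f x \<noteq> 0" by blast
  let ?N = "{s. f s = 0}"
  have "subspace ?N" by (auto simp: subspace_def f.zero f.add f.scaleR)
  moreover have "closed ?N"
    by (intro closed_Collect_eq continuous_intros linear_continuous_on f)
  ultimately obtain p where p: "f p = 0" "\<And>s. f s = 0 \<Longrightarrow> (x - p) \<bullet> s = 0"
    using exists_orthogonal_to_closed_subspace[of ?N x] by auto
  define u where "u = x - p"
  have fu: "f u \<noteq> 0" using x p by (simp add: u_def f.diff)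
  then have uu: "u \<bullet> u \<noteq> 0" using f.zero by auto
  show ?thesis
  proof (intro exI allI)
    fix y
    \<comment> \<open>This combination lies in the kernel of \<open>f\<close>, to which
      \<open>u\<close> is orthogonal; solving for \<open>f y\<close> gives the representing
      vector.\<close>
    have "f (f u *\<^sub>R y - f y *\<^sub>R u) = 0" by (simp add: f.diff f.scaleR)
    then have "u \<bullet> (f u *\<^sub>R y - f y *\<^sub>R u) = 0" using p(2) by (simp add: u_def)
    then show "f y = (f u / (u \<bullet> u)) *\<^sub>R u \<bullet> y"
      using uu by (simp add: inner_diff_right field_simps)
  qed
qed

text \<open>By Tychonoff the sequence \<open>F\<close> lives in a compact box and has a cluster
  point \<open>b\<close>. The index set may be uncountable, so a filter finer than
  \<open>sequentially\<close> takes the place of a subsequence and makes all coordinates converge at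
  once.\<close>

lemma cluster_filter_product_box:
  fixes F :: "nat \<Rightarrow> 'i \<Rightarrow> real"
  assumes bd: "\<And>n i. \<bar>F n i\<bar> \<le> M i"
  shows "\<exists>b U. U \<noteq> bot \<and> U \<le> sequentially \<and> (\<forall>i. ((\<lambda>n. F n i) \<longlongrightarrow> b i) U)"
proof -
  let ?K = "PiE UNIV (\<lambda>i. {- M i .. M i})"
  have "compactin (product_topology (\<lambda>i. euclidean) UNIV) ?K"
    unfolding compactin_PiE by simp
  then have K: "compact ?K" by (simp add: euclidean_product_topology)
  have "F n \<in> ?K" for n
    using bd[of n] by (auto simp: abs_le_iff minus_le_iff PiE_def)
  then have "eventually (\<lambda>x. x \<in> ?K) (filtermap F sequentially)"
    by (simp add: eventually_filtermap)
  moreover have "filtermap F sequentially \<noteq> bot" by (simp add: filtermap_bot_iff)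
  ultimately obtain b where b: "inf (nhds b) (filtermap F sequentially) \<noteq> bot"
    using K unfolding compact_filter by blast
  define U where "U = inf sequentially (filtercomap F (nhds b))"
  have "U \<noteq> bot"
  proof
    assume "U = bot"
    then have "eventually (\<lambda>_. False) U" by simp
    then obtain P R where PR: "eventually P sequentially" "eventually R (nhds b)"
        "\<And>n. P n \<Longrightarrow> R (F n) \<Longrightarrow> False"
      unfolding U_def eventually_inf eventually_filtercomap by metis
    have "eventually (\<lambda>x. \<not> R x) (filtermap F sequentially)"
      unfolding eventually_filtermap using PR(1) by (rule eventually_mono) (use PR(3) in blast)
    with PR(2) have "eventually (\<lambda>_. False) (inf (nhds b) (filtermap F sequentially))"
      unfolding eventually_inf by blast
    with b show False by (simp add: trivial_limit_def)
  qed
  moreover have "((\<lambda>n. F n i) \<longlongrightarrow> b i) U" for i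
  proof -
    have "(F \<longlongrightarrow> b) U" unfolding U_def by (rule filterlim_mono[OF filterlim_filtercomap order_refl inf_le2])
    then have "((\<lambda>n. (\<lambda>x. x i) (F n)) \<longlongrightarrow> (\<lambda>x. x i) b) U"
      by (rule continuous_on_tendsto_compose[OF continuous_on_product_coordinates]) simp_all
    then show ?thesis by simp
  qed
  ultimately show ?thesis by (intro exI[of _ b] exI[of _ U]) (auto simp: U_def)
qed

text \<open>The scalars \<open>F n x \<bullet> y\<close>, indexed by the pairs
  \<open>(x, y)\<close>, lie in a product box. Their limit is a bounded bilinear form, and Riesz
  representation turns it into an operator.\<close>

lemma bounded_operators_weak_cluster:
  fixes F :: "nat \<Rightarrow> 'a::real_normed_vector \<Rightarrow> 'b::{real_inner,banach}"
  assumes lin: "\<And>n. linear (F n)" and bd: "\<And>n x. norm (F n x) \<le> c * norm x"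
  shows "\<exists>Y U. linear Y \<and> (\<forall>x. norm (Y x) \<le> c * norm x) \<and> U \<noteq> bot \<and> U \<le> sequentially \<and>
    (\<forall>x y. ((\<lambda>n. F n x \<bullet> y) \<longlongrightarrow> Y x \<bullet> y) U)"
proof -
  have bd': "\<bar>F n x \<bullet> y\<bar> \<le> c * norm x * norm y" for n x y
    using Cauchy_Schwarz_ineq2[of "F n x" y] mult_right_mono[OF bd[of n x], of "norm y"] by simp
  obtain b U where U: "U \<noteq> bot" "U \<le> sequentially"
      and lim: "\<And>p. ((\<lambda>n. F n (fst p) \<bullet> snd p) \<longlongrightarrow> b p) U"
    using cluster_filter_product_box[of "\<lambda>n p. F n (fst p) \<bullet> snd p" "\<lambda>p. c * norm (fst p) * norm (snd p)"] bd'
    by blast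
  have lim: "((\<lambda>n. F n x \<bullet> y) \<longlongrightarrow> b (x, y)) U" for x y using lim[of "(x, y)"] by simp
  note uniq = tendsto_unique[OF U(1)]
  have bb: "\<bar>b (x, y)\<bar> \<le> c * norm x * norm y" for x y
    by (rule tendsto_upperbound[OF tendsto_rabs[OF lim] _ U(1)]) (simp add: bd')
  have "bounded_linear (\<lambda>y. b (x, y))" for x
  proof (rule bounded_linear_intro)
    show "b (x, y + z) = b (x, y) + b (x, z)" for y z
      using tendsto_add[OF lim[of x y] lim[of x z]] lim[of x "y + z"] uniq
      by (simp add: inner_add_right)
    show "b (x, r *\<^sub>R y) = r *\<^sub>R b (x, y)" for r y
      using tendsto_mult[OF tendsto_const[of r] lim[of x y]] lim[of x "r *\<^sub>R y"] uniq by simp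
    show "norm (b (x, y)) \<le> norm y * (c * norm x)" for y
      using bb[of x y] by (simp add: mult.commute)
  qed
  then have "\<forall>x. \<exists>z. \<forall>y. b (x, y) = z \<bullet> y" using Riesz_representation by blast
  then obtain Y where Y: "\<And>x y. b (x, y) = Y x \<bullet> y" by metis
  note lim = lim[unfolded Y]
  have "linear Y"
  proof (rule linearI)
    fix x y
    have "Y (x + y) \<bullet> z = (Y x + Y y) \<bullet> z" for z
      using tendsto_add[OF lim[of x z] lim[of y z]] lim[of "x + y" z] uniq lin
      by (simp add: inner_add_left linear_add)
    then show "Y (x + y) = Y x + Y y" by (metis vector_eq_rdot)
  next
    fix r x
    have "Y (r *\<^sub>R x) \<bullet> z = (r *\<^sub>R Y x) \<bullet> z" for z
      using tendsto_mult[OF tendsto_const[of r] lim[of x z]] lim[of "r *\<^sub>R x" z] uniq lin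
      by (simp add: linear_scale)
    then show "Y (r *\<^sub>R x) = r *\<^sub>R Y x" by (metis vector_eq_rdot)
  qed
  moreover have "norm (Y x) \<le> c * norm x" for x
  proof (cases "Y x = 0")
    case True
    \<comment> \<open>The right side is nonnegative because it bounds
      \<open>norm (F 0 x)\<close>.\<close>
    then show ?thesis using order_trans[OF norm_ge_zero bd[of 0 x]] by simp
  next
    case False
    have "norm (Y x) * norm (Y x) \<le> c * norm x * norm (Y x)"
      using bb[of x "Y x"] by (simp add: Y flip: power2_norm_eq_inner power2_eq_square)
    with False show ?thesis by simp
  qed
  ultimately show ?thesis using U lim by blast
qed

section \<open>Intertwining extensions over the reals\<close>

text \<open>\<open>V\<close> is the adjoint of \<open>W\<close> for the real inner product, so
  \<open>W_V\<close> is the co-isometry identity.\<close>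

locale coisometry_pair =
  fixes W V :: "'b::{real_inner,banach} \<Rightarrow> 'b"
  assumes linear_W: "linear W" and linear_V: "linear V"
    and adjoint: "W x \<bullet> y = x \<bullet> V y"
    and W_V: "W (V x) = x"
begin

lemma norm_V: "norm (V x) = norm x"
  using adjoint[of "V x" x] by (simp add: W_V norm_eq_sqrt_inner)

lemma norm_W_le: "norm (W x) \<le> norm x"
proof (cases "W x = 0")
  case False
  have "norm (W x) * norm (W x) = x \<bullet> V (W x)"
    using adjoint[of x "W x"] by (simp flip: power2_norm_eq_inner power2_eq_square)
  also have "\<dots> \<le> norm x * norm (W x)" using norm_cauchy_schwarz[of x "V (W x)"] by (simp add: norm_V)
  finally show ?thesis using False by simp
qed simp

lemma bounded_linear_W: "bounded_linear W"
  using linear_W norm_W_le by (auto intro!: bounded_linear_intro[of _ 1] simp: linear_add linear_scale)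

text \<open>Pythagoras: the kernel of \<open>W\<close> is orthogonal to the range of its adjoint
  \<open>V\<close>, and \<open>V\<close> is isometric.\<close>

lemma norm_V_add_ker:
  assumes "W z = 0"
  shows "(norm (V x + z))\<^sup>2 = (norm x)\<^sup>2 + (norm z)\<^sup>2"
proof -
  have "z \<bullet> V x = 0" using adjoint[of z x] assms by simp
  then show ?thesis
    using norm_V[of x] by (simp add: power2_norm_eq_inner inner_add_left inner_add_right
        inner_commute norm_eq_sqrt_inner)
qed

text \<open>The solutions of \<open>W Y = R\<close> are \<open>V R + Z\<close> with \<open>Z\<close>
  mapping into the kernel of \<open>W\<close>. By Pythagoras, the bound \<open>c\<close> on
  \<open>Y\<close> says exactly that the square of \<open>norm (Z x)\<close> is at most
  \<open>g x x\<close>, so the problem becomes a dominated extension of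
  \<open>Z\<^sub>0\<close>.\<close>

lemma lift_through_coisometry:
  fixes H :: "'a::real_inner set" and X R :: "'a \<Rightarrow> 'b"
  assumes H: "subspace H"
    and Xadd: "\<And>x y. x \<in> H \<Longrightarrow> y \<in> H \<Longrightarrow> X (x + y) = X x + X y"
    and Xscale: "\<And>r x. x \<in> H \<Longrightarrow> X (r *\<^sub>R x) = r *\<^sub>R X x"
    and Xbd: "\<And>x. x \<in> H \<Longrightarrow> norm (X x) \<le> c * norm x"
    and R: "linear R" "\<And>x. norm (R x) \<le> c * norm x"
    and c: "c \<ge> 0"
    and WX: "\<And>x. x \<in> H \<Longrightarrow> W (X x) = R x"
  shows "\<exists>Y. linear Y \<and> (\<forall>x\<in>H. Y x = X x) \<and> (\<forall>x. norm (Y x) \<le> c * norm x) \<and> (\<forall>x. W (Y x) = R x)"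
proof -
  define g where "g x y = c\<^sup>2 * (x \<bullet> y) - R x \<bullet> R y" for x y
  have gxx: "g x x = (c * norm x)\<^sup>2 - (norm (R x))\<^sup>2" for x
    by (simp add: g_def power_mult_distrib power2_norm_eq_inner)
  interpret semi_inner g
  proof
    show "g x x \<ge> 0" for x
      using R(2)[of x] by (simp add: gxx power_mono)
  qed (simp_all add: g_def linear_add[OF R(1)] linear_scale[OF R(1)] inner_add_left algebra_simps inner_commute)
  define Z\<^sub>0 where "Z\<^sub>0 x = X x - V (R x)" for x
  have WZ0: "W (Z\<^sub>0 x) = 0" if "x \<in> H" for x
    using that by (simp add: Z\<^sub>0_def linear_diff[OF linear_W] W_V WX)
  have "\<exists>Z. linear Z \<and> (\<forall>x\<in>H. Z x = Z\<^sub>0 x) \<and> (\<forall>x. norm (Z x) \<le> sqrt (g x x)) \<and>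
    (\<forall>x. Z x \<in> closure (Z\<^sub>0 ` H))"
  proof (rule extend_dominated[OF H])
    fix x assume x: "x \<in> H"
    have "(norm (X x))\<^sup>2 = (norm (R x))\<^sup>2 + (norm (Z\<^sub>0 x))\<^sup>2"
      using norm_V_add_ker[OF WZ0[OF x], of "R x"] by (simp add: Z\<^sub>0_def)
    moreover have "(norm (X x))\<^sup>2 \<le> (c * norm x)\<^sup>2" using Xbd[OF x] by (simp add: power_mono)
    ultimately show "norm (Z\<^sub>0 x) \<le> sqrt (g x x)" by (intro real_le_rsqrt) (simp add: gxx)
  qed (simp_all add: Z\<^sub>0_def Xadd Xscale linear_add[OF R(1)] linear_scale[OF R(1)]
      linear_add[OF linear_V] linear_scale[OF linear_V] algebra_simps)
  then obtain Z where Z: "linear Z" "\<And>x. x \<in> H \<Longrightarrow> Z x = Z\<^sub>0 x"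
      "\<And>x. norm (Z x) \<le> sqrt (g x x)" "\<And>x. Z x \<in> closure (Z\<^sub>0 ` H)" by blast
  have "closed {z. W z = 0}"
    by (intro closed_Collect_eq continuous_intros linear_continuous_on bounded_linear_W)
  \<comment> \<open>The kernel of \<open>W\<close> is closed, so taking the closure of the values of
    \<open>Z\<^sub>0\<close> does not leave it.\<close>
  then have "closure (Z\<^sub>0 ` H) \<subseteq> {z. W z = 0}" by (intro closure_minimal) (use WZ0 in auto)
  then have WZ: "W (Z x) = 0" for x using Z(4) by auto
  show ?thesis
  proof (intro exI conjI allI ballI)
    show "linear (\<lambda>x. V (R x) + Z x)"
      using linear_compose_add[OF linear_compose[OF R(1) linear_V] Z(1)] by (simp add: o_def)
    show "V (R x) + Z x = X x" if "x \<in> H" for x using that by (simp add: Z Z\<^sub>0_def)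
    show "W (V (R x) + Z x) = R x" for x by (simp add: linear_add[OF linear_W] W_V WZ)
    show "norm (V (R x) + Z x) \<le> c * norm x" for x
    proof (rule power2_le_imp_le)
      have "(norm (Z x))\<^sup>2 \<le> g x x" using Z(3)[of x] pos[of x]
        by (metis norm_ge_zero power_mono real_sqrt_pow2)
      then show "(norm (V (R x) + Z x))\<^sup>2 \<le> (c * norm x)\<^sup>2"
        by (simp add: norm_V_add_ker WZ gxx)
    qed (use c in simp)
  qed
qed

text \<open>Repeated lifting gives extensions with \<open>W (Y (Suc n) x) = Y n (A x)\<close>.
  Averaging over \<open>n\<close> makes the index shift negligible, so a weak cluster point of the
  averages intertwines exactly.\<close>

theorem intertwining_extension:
  fixes H :: "'a::real_inner set" and X :: "'a \<Rightarrow> 'b" and A :: "'a \<Rightarrow> 'a"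
  assumes H: "subspace H"
    and Xadd: "\<And>x y. x \<in> H \<Longrightarrow> y \<in> H \<Longrightarrow> X (x + y) = X x + X y"
    and Xscale: "\<And>r x. x \<in> H \<Longrightarrow> X (r *\<^sub>R x) = r *\<^sub>R X x"
    and Xbd: "\<And>x. x \<in> H \<Longrightarrow> norm (X x) \<le> c * norm x"
    and c: "c \<ge> 0"
    and A: "linear A" "\<And>x. norm (A x) \<le> norm x" "\<And>x. x \<in> H \<Longrightarrow> A x \<in> H"
    and XA: "\<And>x. x \<in> H \<Longrightarrow> X (A x) = W (X x)"
  shows "\<exists>Y. linear Y \<and> (\<forall>x\<in>H. Y x = X x) \<and> (\<forall>x. norm (Y x) \<le> c * norm x) \<and>
    (\<forall>x. Y (A x) = W (Y x))"
proof -
  define P where "P Y \<longleftrightarrow> linear Y \<and> (\<forall>x\<in>H. Y x = X x) \<and> (\<forall>x. norm (Y x) \<le> c * norm x)" for Y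
  have "\<exists>Y. P Y"
  proof -
    \<comment> \<open>The scaled inner product dominates \<open>X\<close> and provides a starting
      extension, with no intertwining required yet.\<close>
    have "semi_inner (\<lambda>x y :: 'a. c\<^sup>2 * (x \<bullet> y))"
      by unfold_locales (auto simp: inner_add_left inner_commute algebra_simps)
    from semi_inner.extend_dominated[OF this H, of X] Xadd Xscale Xbd c
    show ?thesis by (auto simp: P_def real_sqrt_mult norm_eq_sqrt_inner)
  qed
  moreover have "\<exists>Y'. P Y' \<and> (\<forall>x. W (Y' x) = Y (A x))" if Y: "P Y" for Y
  proof -
    have "\<exists>Y'. linear Y' \<and> (\<forall>x\<in>H. Y' x = X x) \<and> (\<forall>x. norm (Y' x) \<le> c * norm x) \<and> (\<forall>x. W (Y' x) = Y (A x))"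
    proof (rule lift_through_coisometry[OF H Xadd Xscale Xbd _ _ c])
      show "linear (\<lambda>x. Y (A x))" using linear_compose[OF A(1), of Y] Y by (simp add: P_def o_def)
      show "norm (Y (A x)) \<le> c * norm x" for x
        using Y mult_left_mono[OF A(2)[of x] c] unfolding P_def by (meson order_trans)
      \<comment> \<open>Compatibility on \<open>H\<close> holds since \<open>A\<close> keeps
        \<open>H\<close> invariant and \<open>Y\<close> agrees with \<open>X\<close> there.\<close>
      show "W (X x) = Y (A x)" if "x \<in> H" for x
        using that Y A(3) XA by (simp add: P_def)
    qed
    then show ?thesis by (auto simp: P_def)
  qed
  ultimately obtain Y where Y: "\<And>n. P (Y n)" and step: "\<And>n x. W (Y (Suc n) x) = Y n (A x)"
    using dependent_nat_choice[of "\<lambda>_. P" "\<lambda>_ Y Y'. \<forall>x. W (Y' x) = Y (A x)"] by blast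
  have Ylin: "linear (Y n)" and YX: "x \<in> H \<Longrightarrow> Y n x = X x" and Ybd: "norm (Y n x) \<le> c * norm x" for n x
    using Y by (auto simp: P_def)
  define C where "C N x = (1 / real (Suc N)) *\<^sub>R (\<Sum>n\<le>N. Y n x)" for N x
  have Clin: "linear (C N)" for N
    unfolding C_def by (intro linear_compose_scale_right linear_compose_sum ballI Ylin)
  have CX: "C N x = X x" if "x \<in> H" for N x
    using that by (simp add: C_def YX sum_constant_scaleR)
  have Cbd: "norm (C N x) \<le> c * norm x" for N x
  proof -
    have "norm (\<Sum>n\<le>N. Y n x) \<le> (\<Sum>n\<le>N. c * norm x)" by (intro sum_norm_le Ybd)
    then show ?thesis by (simp add: C_def field_simps)
  qed
  \<comment> \<open>The telescoping sum makes the Cesaro means intertwine up to \<open>O(1/N)\<close>.\<close>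
  have CA: "norm (W (C N x) - C N (A x)) \<le> (2 * c * norm x) * (1 / real (Suc N))" for N x
  proof -
    have "W (\<Sum>n\<le>N. Y n x) - (\<Sum>n\<le>N. Y n (A x)) = W (Y 0 x) - Y N (A x)"
    proof (induction N)
      case (Suc N)
      then show ?case by (simp add: linear_add[OF linear_W] step algebra_simps)
    qed simp
    then have "W (C N x) - C N (A x) = (1 / real (Suc N)) *\<^sub>R (W (Y 0 x) - Y N (A x))"
      by (simp only: C_def linear_scale[OF linear_W] flip: scaleR_diff_right)
    moreover have "norm (W (Y 0 x) - Y N (A x)) \<le> 2 * c * norm x"
    proof -
      have "norm (W (Y 0 x)) \<le> c * norm x" using norm_W_le Ybd order_trans by blast
      moreover have "norm (Y N (A x)) \<le> c * norm x"
        using Ybd[of N "A x"] mult_left_mono[OF A(2)[of x] c] by linarith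
      ultimately show ?thesis using norm_triangle_ineq4[of "W (Y 0 x)" "Y N (A x)"] by linarith
    qed
    ultimately show ?thesis by (simp add: divide_right_mono)
  qed
  obtain L U where Yi: "linear L" "\<And>x. norm (L x) \<le> c * norm x"
      and U: "U \<noteq> bot" "U \<le> sequentially"
      and lim: "\<And>x y. ((\<lambda>n. C n x \<bullet> y) \<longlongrightarrow> L x \<bullet> y) U"
    using bounded_operators_weak_cluster[of C c, OF Clin Cbd] by blast
  have "L x = X x" if "x \<in> H" for x
  proof -
    have "L x \<bullet> y = X x \<bullet> y" for y
      using tendsto_unique[OF U(1) lim[of x y]] CX[OF that] by simp
    then show ?thesis by (metis vector_eq_rdot)
  qed
  moreover have "L (A x) = W (L x)" for x
  proof -
    have "W (L x) \<bullet> y = L (A x) \<bullet> y" for y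
    proof -
      have "(\<lambda>n. W (C n x) - C n (A x)) \<longlonglongrightarrow> 0"
      proof (rule Lim_null_comparison)
        show "(\<lambda>n. (2 * c * norm x) * (1 / real (Suc n))) \<longlonglongrightarrow> 0"
          using tendsto_mult_left[OF LIMSEQ_Suc[OF lim_1_over_n], of "2 * c * norm x"] by simp
      qed (use CA in simp)
      then have "((\<lambda>n. (W (C n x) - C n (A x)) \<bullet> y) \<longlongrightarrow> 0 \<bullet> y) U"
        by (intro tendsto_inner tendsto_const tendsto_mono[OF U(2)])
      \<comment> \<open>Moving \<open>W\<close> to the other side as \<open>V\<close> lets the weak
        limit pass through \<open>W\<close>.\<close>
      moreover have "((\<lambda>n. (W (C n x) - C n (A x)) \<bullet> y) \<longlongrightarrow> L x \<bullet> V y - L (A x) \<bullet> y) U"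
        using tendsto_diff[OF lim[of x "V y"] lim[of "A x" y]] by (simp add: inner_diff_left adjoint)
      ultimately show ?thesis using tendsto_unique[OF U(1)] by (fastforce simp: adjoint)
    qed
    then show ?thesis by (metis vector_eq_rdot)
  qed
  ultimately show ?thesis using Yi by blast
qed

end

section \<open>Complex structure\<close>

instance complex_hilbert \<subseteq> banach ..

lemma scaleC_of_real: "complex_of_real r *\<^sub>C x = r *\<^sub>R x"
  by (simp add: scaleC_def)

lemma scaleC_i: "\<i> *\<^sub>C x = imult x"
  by (simp add: scaleC_def)

lemma linear_imult: "linear imult"
  by (intro linearI imult_add imult_scaleR)

lemma norm_imult: "norm (imult x) = norm x"
  by (simp add: norm_eq_sqrt_inner inner_imult)

lemma inner_eq_of_cinner_eq: "cinner x y = cinner u v \<Longrightarrow> inner x y = inner u v"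
  by (simp add: cinner_def)

lemma csubspace_subspace: "csubspace H \<Longrightarrow> subspace H"
  unfolding csubspace_def subspace_def by (metis scaleC_of_real)

lemma csubspace_imult: "csubspace H \<Longrightarrow> x \<in> H \<Longrightarrow> imult x \<in> H"
  unfolding csubspace_def by (metis scaleC_i)

lemma bounded_op_on_scaleR: "bounded_op_on H A \<Longrightarrow> x \<in> H \<Longrightarrow> A (r *\<^sub>R x) = r *\<^sub>R A x"
  unfolding bounded_op_on_def by (metis scaleC_of_real)

lemma bounded_op_on_imult: "bounded_op_on H A \<Longrightarrow> x \<in> H \<Longrightarrow> A (imult x) = imult (A x)"
  unfolding bounded_op_on_def by (metis scaleC_i)

lemma bounded_op_on_UNIV_linear: "bounded_op_on UNIV A \<Longrightarrow> linear A"
  by (rule linearI, simp add: bounded_op_on_def, simp add: bounded_op_on_scaleR)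

lemma bounded_op_on_UNIV_I:
  assumes "linear A" "\<And>x. A (imult x) = imult (A x)" "\<And>x. norm (A x) \<le> c * norm x"
  shows "bounded_op_on UNIV A"
  using assms unfolding bounded_op_on_def scaleC_def
  by (auto simp: linear_add linear_scale)

section \<open>The operator norm on a subspace\<close>

lemma norm_le_opnorm_on_ball:
  assumes A: "bounded_op_on H A" and x: "x \<in> H" "norm x \<le> 1"
  shows "norm (A x) \<le> opnorm_on H A"
proof -
  obtain C where C: "\<And>x. x \<in> H \<Longrightarrow> norm (A x) \<le> C * norm x"
    using A unfolding bounded_op_on_def by blast
  \<comment> \<open>The absolute value is taken because \<open>C\<close> may be negative, for
    instance when \<open>H\<close> is trivial.\<close>
  have "norm (A y) \<le> \<bar>C\<bar>" if "y \<in> H" "norm y \<le> 1" for y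
  proof -
    have "norm (A y) \<le> \<bar>C\<bar> * norm y"
      using C[OF that(1)] mult_right_mono[OF abs_ge_self[of C] norm_ge_zero[of y]] by linarith
    also have "\<dots> \<le> \<bar>C\<bar>" using that mult_left_mono[of "norm y" 1 "\<bar>C\<bar>"] by simp
    finally show ?thesis .
  qed
  then have "bdd_above ((\<lambda>x. norm (A x)) ` {x\<in>H. norm x \<le> 1})"
    by (auto intro!: bdd_aboveI[of _ "\<bar>C\<bar>"])
  then show ?thesis
    unfolding opnorm_on_def using x by (auto intro!: cSup_upper)
qed

lemma norm_le_opnorm_on:
  assumes H: "csubspace H" and A: "bounded_op_on H A" and x: "x \<in> H"
  shows "norm (A x) \<le> opnorm_on H A * norm x"
proof (cases "x = 0")
  case True
  then show ?thesis using bounded_op_on_scaleR[OF A x, of 0] by simp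
next
  case False
  have "(1 / norm x) *\<^sub>R x \<in> H" using csubspace_subspace[OF H] x by (rule subspace_scale)
  then have "norm (A ((1 / norm x) *\<^sub>R x)) \<le> opnorm_on H A"
    using False by (intro norm_le_opnorm_on_ball[OF A]) auto
  then show ?thesis using False bounded_op_on_scaleR[OF A x, of "1 / norm x"]
    by (simp add: field_simps)
qed

lemma opnorm_on_nonneg:
  assumes "csubspace H" "bounded_op_on H A"
  shows "opnorm_on H A \<ge> 0"
proof -
  have "0 \<in> H" using assms(1) by (simp add: csubspace_def)
  then have "norm (A 0) \<le> opnorm_on H A" using norm_le_opnorm_on_ball[OF assms(2)] by simp
  then show ?thesis using norm_ge_zero order_trans by blast
qed

lemma opnorm_on_le:
  assumes "csubspace H" "\<And>x. x \<in> H \<Longrightarrow> norm (A x) \<le> c * norm x" "c \<ge> 0"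
  shows "opnorm_on H A \<le> c"
  unfolding opnorm_on_def
proof (rule cSup_least)
  show "(\<lambda>x. norm (A x)) ` {x \<in> H. norm x \<le> 1} \<noteq> {}"
    using assms(1) by (auto simp: csubspace_def intro!: exI[of _ 0])
next
  fix r assume "r \<in> (\<lambda>x. norm (A x)) ` {x \<in> H. norm x \<le> 1}"
  then obtain x where "x \<in> H" "norm x \<le> 1" "r = norm (A x)" by blast
  then show "r \<le> c" using assms(2)[of x] mult_left_mono[of "norm x" 1 c] assms(3) by simp
qed

section \<open>Passage between the complex statement and the real argument\<close>

text \<open>The real part of the complex adjoint identity gives the real one. The complex identity
  is kept for building the adjoint of a composition later.\<close>

lemma coisometry_imp_pair:
  assumes "bounded_op_on UNIV W" "coisometry W"
  shows "\<exists>V. bounded_op_on UNIV V \<and> (\<forall>x y. cinner (W x) y = cinner x (V y)) \<and> coisometry_pair W V"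
proof -
  obtain V where V: "bounded_op_on UNIV V" "\<And>x y. cinner (W x) y = cinner x (V y)" "\<And>x. W (V x) = x"
    using assms(2) unfolding coisometry_def by blast
  have "coisometry_pair W V"
    using V assms(1) by (intro coisometry_pair.intro) (auto intro: bounded_op_on_UNIV_linear inner_eq_of_cinner_eq)
  with V show ?thesis by blast
qed

text \<open>The real theorem is applied with \<open>c\<close> the norm of \<open>X\<close>.
  Averaging preserves the bound because \<open>imult\<close> is isometric, and the intertwining
  because \<open>A\<close> and \<open>W\<close> commute with \<open>imult\<close>. The reverse norm
  inequality holds since \<open>Y\<close> restricts to \<open>X\<close>.\<close>

lemma complex_intertwining_extension:
  fixes H :: "'a::complex_hilbert set" and X A W :: "'a \<Rightarrow> 'a"
  assumes H: "csubspace H" and X: "bounded_op_on H X"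
    and A: "contraction_on UNIV A" "\<And>x. x \<in> H \<Longrightarrow> A x \<in> H"
    and W: "bounded_op_on UNIV W" "coisometry W"
    and XA: "\<And>x. x \<in> H \<Longrightarrow> X (A x) = W (X x)"
  shows "\<exists>Y. bounded_op_on UNIV Y \<and> extends_on H Y X \<and> (\<forall>x. Y (A x) = W (Y x)) \<and>
    opnorm_on UNIV Y = opnorm_on H X"
proof -
  let ?c = "opnorm_on H X"
  have c: "?c \<ge> 0" using opnorm_on_nonneg[OF H X] .
  have Aop: "bounded_op_on UNIV A" and Abd: "\<And>x. norm (A x) \<le> norm x"
    using A(1) by (auto simp: contraction_on_def)
  obtain V where "coisometry_pair W V" using coisometry_imp_pair[OF W] by blast
  then interpret coisometry_pair W V .
  have "\<exists>Y. linear Y \<and> (\<forall>x\<in>H. Y x = X x) \<and> (\<forall>x. norm (Y x) \<le> ?c * norm x) \<and>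
      (\<forall>x. Y (A x) = W (Y x))"
    by (rule intertwining_extension)
      (use H X c A(2) XA Abd in \<open>auto simp: csubspace_subspace bounded_op_on_scaleR
        norm_le_opnorm_on bounded_op_on_UNIV_linear[OF Aop] bounded_op_on_def\<close>)
  then obtain Y where Y: "linear Y" "\<And>x. x \<in> H \<Longrightarrow> Y x = X x" "\<And>x. norm (Y x) \<le> ?c * norm x"
      "\<And>x. Y (A x) = W (Y x)" by blast
  \<comment> \<open>\<open>Y\<close> is only real-linear; averaging over multiplication by \<open>i\<close> makes it complex-linear.\<close>
  define Y' where "Y' x = (1/2) *\<^sub>R (Y x - imult (Y (imult x)))" for x
  have lin: "linear Y'"
    by (rule linearI)
      (simp_all add: Y'_def linear_add[OF Y(1)] linear_scale[OF Y(1)] imult_add imult_scaleR algebra_simps)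
  have im: "Y' (imult x) = imult (Y' x)" for x
    by (simp add: Y'_def imult_imult imult_scaleR linear_diff[OF linear_imult] linear_neg[OF Y(1)]
        linear_neg[OF linear_imult])
  have bd: "norm (Y' x) \<le> ?c * norm x" for x
    using norm_triangle_ineq4[of "Y x" "imult (Y (imult x))"] Y(3)[of x] Y(3)[of "imult x"]
    by (simp add: Y'_def norm_imult)
  have YX: "Y' x = X x" if "x \<in> H" for x
  proof -
    have "Y (imult x) = imult (X x)"
      using that Y(2) csubspace_imult[OF H] bounded_op_on_imult[OF X] by simp
    then show ?thesis using Y(2)[OF that] by (simp add: Y'_def imult_imult flip: scaleR_2)
  qed
  have YA: "Y' (A x) = W (Y' x)" for x
    using bounded_op_on_imult[OF Aop, of x] bounded_op_on_imult[OF W(1), of "Y (imult x)"]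
    by (simp add: Y'_def linear_scale[OF linear_W] linear_diff[OF linear_W] flip: Y(4))
  have op: "bounded_op_on UNIV Y'" using lin im bd by (rule bounded_op_on_UNIV_I)
  have U: "csubspace (UNIV :: 'a set)" by (simp add: csubspace_def)
  have "opnorm_on UNIV Y' = ?c"
  proof (rule antisym)
    show "opnorm_on UNIV Y' \<le> ?c" using U bd c by (rule opnorm_on_le)
    show "?c \<le> opnorm_on UNIV Y'"
      using norm_le_opnorm_on[OF U op UNIV_I] by (intro opnorm_on_le[OF H] opnorm_on_nonneg[OF U op]) (metis YX)
  qed
  with op YX YA show ?thesis unfolding extends_on_def by blast
qed

text \<open>Any candidate \<open>p\<close> for the choice in \<open>proj\<close> has
  \<open>x - p\<close> in both \<open>H\<close> and its orthogonal complement, hence equals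
  \<open>x\<close>.\<close>

lemma proj_id:
  assumes "csubspace H" "x \<in> H"
  shows "proj H x = x"
proof -
  have sub: "subspace H" by (rule csubspace_subspace[OF assms(1)])
  have "p = x" if "p \<in> H" "x - p \<in> orth_compl H" for p
  proof -
    have "x - p \<in> H" using sub assms(2) that(1) by (rule subspace_diff)
    with that(2) have "inner (x - p) (x - p) = 0" by (simp add: orth_compl_def cinner_def complex_eq_iff)
    then show ?thesis by simp
  qed
  moreover have "x - x \<in> orth_compl H"
    by (simp add: orth_compl_def cinner_def complex_eq_iff linear_0[OF linear_imult])
  ultimately show ?thesis unfolding proj_def using assms(2) by (metis (mono_tags, lifting) someI_ex)
qed

lemma extends_on_funpow:
  assumes "extends_on H S A" "\<And>x. x \<in> H \<Longrightarrow> A x \<in> H" "x \<in> H"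
  shows "(S ^^ n) x = (A ^^ n) x \<and> (A ^^ n) x \<in> H"
  using assms by (induction n) (auto simp: extends_on_def)

text \<open>The orbit of \<open>x\<close> never leaves \<open>H\<close>, where the extensions agree
  with the original operators and the projection acts as the identity.\<close>

lemma powers_eq_proj_extensions:
  assumes H: "csubspace H" and S: "extends_on H S A" "extends_on H R B"
    and inv: "\<And>x. x \<in> H \<Longrightarrow> A x \<in> H" "\<And>x. x \<in> H \<Longrightarrow> B x \<in> H" and x: "x \<in> H"
  shows "(A ^^ n) ((B ^^ m) x) = proj H ((S ^^ n) ((R ^^ m) x))"
  using extends_on_funpow[OF S(1) inv(1)] extends_on_funpow[OF S(2) inv(2) x, of m]
  by (simp add: proj_id[OF H])

section \<open>Compositions of contractions, unitaries and co-isometries\<close>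

lemma coisometry_norm_le:
  assumes "bounded_op_on UNIV W" "coisometry W"
  shows "norm (W x) \<le> norm x"
  using coisometry_imp_pair[OF assms] coisometry_pair.norm_W_le by blast

lemma contraction_on_UNIV_compose:
  fixes A B :: "'a::complex_hilbert \<Rightarrow> 'a"
  assumes A: "contraction_on UNIV A" and B: "contraction_on UNIV B"
  shows "contraction_on UNIV (\<lambda>x. A (B x))"
proof -
  have bd: "norm (A (B x)) \<le> norm x" for x
    using A B unfolding contraction_on_def by (meson UNIV_I order_trans)
  have "linear (\<lambda>x. A (B x))"
    using linear_compose[of B A] A B by (simp add: o_def contraction_on_def bounded_op_on_UNIV_linear)
  then have "bounded_op_on UNIV (\<lambda>x. A (B x))"
    by (rule bounded_op_on_UNIV_I[where c = 1])
      (use A B bd in \<open>auto simp: contraction_on_def bounded_op_on_imult\<close>)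
  with bd show ?thesis by (simp add: contraction_on_def)
qed

lemma unitary_bij_norm:
  assumes "unitary_on UNIV U"
  shows "bij U" and "norm (U x) = norm x"
proof -
  have lin: "linear U" and iso: "\<And>x y. inner (U x) (U y) = inner x y" and "surj U"
    using assms unfolding unitary_on_def by (auto intro: bounded_op_on_UNIV_linear inner_eq_of_cinner_eq)
  have n: "norm (U x) = norm x" for x using iso by (simp add: norm_eq_sqrt_inner)
  then show "norm (U x) = norm x" .
  have "inj U" unfolding linear_injective_0[OF lin] using n by (metis norm_eq_zero)
  with \<open>surj U\<close> show "bij U" by (simp add: bij_def)
qed

text \<open>The inverse of \<open>U\<close> is its adjoint, so the adjoint of the composition is
  \<open>V\<close> after \<open>U\<close>; applying the composition to \<open>V (U x)\<close>
  cancels first \<open>W\<close> with \<open>V\<close>, then \<open>inv U\<close> with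
  \<open>U\<close>.\<close>

lemma coisometry_inv_unitary_compose:
  fixes U W :: "'a::complex_hilbert \<Rightarrow> 'a"
  assumes U: "unitary_on UNIV U" and W: "bounded_op_on UNIV W" "coisometry W"
  shows "bounded_op_on UNIV (\<lambda>x. inv U (W x))" and "coisometry (\<lambda>x. inv U (W x))"
proof -
  have Uop: "bounded_op_on UNIV U" using U by (simp add: unitary_on_def)
  have lin: "linear U" using Uop by (rule bounded_op_on_UNIV_linear)
  note bij = unitary_bij_norm(1)[OF U] and n = unitary_bij_norm(2)[OF U]
  have U_inv: "U (inv U x) = x" and inv_U: "inv U (U x) = x" for x
    using bij by (simp_all add: bij_def surj_f_inv_f)
  have eqI: "inv U x = y" if "x = U y" for x y using that inv_U by simp
  have linv: "linear (inv U)"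
    by (rule linearI) (auto intro!: eqI simp: linear_add[OF lin] linear_scale[OF lin] U_inv)
  have "norm (inv U x) \<le> 1 * norm x" for x using n[of "inv U x"] by (simp add: U_inv)
  moreover have "inv U (imult x) = imult (inv U x)" for x
    by (rule eqI) (simp add: bounded_op_on_imult[OF Uop] U_inv)
  ultimately have con: "contraction_on UNIV (inv U)"
    using bounded_op_on_UNIV_I[OF linv, of 1] by (simp add: contraction_on_def)
  have Wcon: "contraction_on UNIV W"
    using W(1) coisometry_norm_le[OF W(1,2)] by (simp add: contraction_on_def)
  show "bounded_op_on UNIV (\<lambda>x. inv U (W x))"
    using contraction_on_UNIV_compose[OF con Wcon] by (simp add: contraction_on_def)
  obtain V where V: "bounded_op_on UNIV V" "\<And>x y. cinner (W x) y = cinner x (V y)" "coisometry_pair W V"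
    using coisometry_imp_pair[OF W] by blast
  interpret coisometry_pair W V by (rule V)
  have Vcon: "contraction_on UNIV V" using V(1) norm_V by (simp add: contraction_on_def)
  have Ucon: "contraction_on UNIV U" using Uop n by (simp add: contraction_on_def)
  show "coisometry (\<lambda>x. inv U (W x))"
    unfolding coisometry_def
  proof (intro exI conjI allI)
    show "bounded_op_on UNIV (\<lambda>x. V (U x))"
      using contraction_on_UNIV_compose[OF Vcon Ucon] by (simp add: contraction_on_def)
    show "inv U (W (V (U x))) = x" for x by (simp add: W_V inv_U)
    fix x y
    have "cinner (inv U (W x)) y = cinner (U (inv U (W x))) (U y)"
      using U by (simp add: unitary_on_def)
    then show "cinner (inv U (W x)) y = cinner x (V (U y))" by (simp add: U_inv V(2))
  qed
qed

section \<open>Specialisation to the three intertwining relations\<close>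

theorem mainTheorem5:
  fixes H :: "'a::complex_hilbert set"
    and T X Q Qb W :: "'a \<Rightarrow> 'a"
  assumes H: "hilbert_subspace H"
    and T: "contraction_on H T"
    and W: "bounded_op_on UNIV W" "coisometry W" "extends_on H W T"
    and X: "bounded_op_on H X"
    and Q: "contraction_on H Q"
    and Qb: "contraction_on UNIV Qb" "reduces H Qb" "extends_on H Qb Q"
  shows
   "((\<forall>h\<in>H. X (T (Q h)) = T (X h)) \<longrightarrow>
      (\<exists>Y. bounded_op_on UNIV Y \<and> extends_on H Y X \<and>
           (\<forall>k. Y (W (Qb k)) = W (Y k)) \<and>
           (\<forall>n m. \<forall>h\<in>H. (T ^^ n) ((X ^^ m) h) = proj H ((W ^^ n) ((Y ^^ m) h)) \<and>
                           (X ^^ n) ((T ^^ m) h) = proj H ((Y ^^ n) ((W ^^ m) h))) \<and>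
           opnorm_on UNIV Y = opnorm_on H X))
  \<and> ((\<forall>h\<in>H. X (Q (T h)) = T (X h)) \<longrightarrow>
      (\<exists>Y. bounded_op_on UNIV Y \<and> extends_on H Y X \<and>
           (\<forall>k. Y (Qb (W k)) = W (Y k)) \<and>
           (\<forall>n m. \<forall>h\<in>H. (T ^^ n) ((X ^^ m) h) = proj H ((W ^^ n) ((Y ^^ m) h)) \<and>
                           (X ^^ n) ((T ^^ m) h) = proj H ((Y ^^ n) ((W ^^ m) h))) \<and>
           opnorm_on UNIV Y = opnorm_on H X))
  \<and> (unitary_on H Q \<and> unitary_on UNIV Qb \<and> (\<forall>h\<in>H. Q (X (T h)) = T (X h)) \<longrightarrow>
      (\<exists>Y. bounded_op_on UNIV Y \<and> extends_on H Y X \<and>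
           (\<forall>k. Qb (Y (W k)) = W (Y k)) \<and>
           (\<forall>n m. \<forall>h\<in>H. (T ^^ n) ((X ^^ m) h) = proj H ((W ^^ n) ((Y ^^ m) h)) \<and>
                           (X ^^ n) ((T ^^ m) h) = proj H ((Y ^^ n) ((W ^^ m) h))) \<and>
           opnorm_on UNIV Y = opnorm_on H X))"
proof -
  have cs: "csubspace H" using H by (simp add: hilbert_subspace_def)
  have TH: "T h \<in> H" and XH: "X h \<in> H" and QH: "Q h \<in> H" if "h \<in> H" for h
    using that T X Q by (auto simp: contraction_on_def bounded_op_on_def)
  have Wh: "W h = T h" and Qbh: "Qb h = Q h" if "h \<in> H" for h
    using that W(3) Qb(3) by (auto simp: extends_on_def)
  have Wcon: "contraction_on UNIV W"
    using W(1) coisometry_norm_le[OF W(1,2)] by (simp add: contraction_on_def)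
  \<comment> \<open>The power identities use only that \<open>Y\<close> extends \<open>X\<close>, so
    one proof serves all three cases.\<close>
  have pow: "(T ^^ n) ((X ^^ m) h) = proj H ((W ^^ n) ((Y ^^ m) h)) \<and>
      (X ^^ n) ((T ^^ m) h) = proj H ((Y ^^ n) ((W ^^ m) h))"
    if "extends_on H Y X" "h \<in> H" for Y n m h
    using that W(3) TH XH cs by (simp add: powers_eq_proj_extensions)
  \<comment> \<open>On \<open>H\<close> the operators \<open>W\<close> and \<open>Qb\<close> act as
    \<open>T\<close> and \<open>Q\<close>, so the hypothesis is the intertwining of \<open>X\<close>
    with the contraction \<open>W\<close> after \<open>Qb\<close>.\<close>
  have main1: "\<exists>Y. bounded_op_on UNIV Y \<and> extends_on H Y X \<and> (\<forall>k. Y (W (Qb k)) = W (Y k)) \<and>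
      opnorm_on UNIV Y = opnorm_on H X"
    if "\<forall>h\<in>H. X (T (Q h)) = T (X h)"
    by (rule complex_intertwining_extension[OF cs X contraction_on_UNIV_compose[OF Wcon Qb(1)] _ W(1,2)])
      (use that in \<open>simp_all add: Wh Qbh TH XH QH\<close>)
  have main2: "\<exists>Y. bounded_op_on UNIV Y \<and> extends_on H Y X \<and> (\<forall>k. Y (Qb (W k)) = W (Y k)) \<and>
      opnorm_on UNIV Y = opnorm_on H X"
    if "\<forall>h\<in>H. X (Q (T h)) = T (X h)"
    by (rule complex_intertwining_extension[OF cs X contraction_on_UNIV_compose[OF Qb(1) Wcon] _ W(1,2)])
      (use that in \<open>simp_all add: Wh Qbh TH XH QH\<close>)
  \<comment> \<open>Here \<open>X T = Q\<^sup>* T X\<close>, and \<open>Qb\<^sup>* W\<close> is again a coisometry.\<close>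
  have main3: "\<exists>Y. bounded_op_on UNIV Y \<and> extends_on H Y X \<and> (\<forall>k. Qb (Y (W k)) = W (Y k)) \<and>
      opnorm_on UNIV Y = opnorm_on H X"
    if U: "unitary_on UNIV Qb" and QXT: "\<forall>h\<in>H. Q (X (T h)) = T (X h)"
  proof -
    have bij: "bij Qb" by (rule unitary_bij_norm(1)[OF U])
    have "X (W h) = inv Qb (W (X h))" if h: "h \<in> H" for h
    proof -
      \<comment> \<open>Since \<open>X (T h)\<close> lies in \<open>H\<close>, \<open>Qb\<close>
        acts on it as \<open>Q\<close>.\<close>
      have "W (X h) = Qb (X (W h))" using QXT h by (simp add: Wh Qbh TH XH)
      then show ?thesis using bij by (simp add: bij_def)
    qed
    then obtain Y where "bounded_op_on UNIV Y" "extends_on H Y X" "\<forall>k. Y (W k) = inv Qb (W (Y k))"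
        "opnorm_on UNIV Y = opnorm_on H X"
      using complex_intertwining_extension[OF cs X Wcon _ coisometry_inv_unitary_compose[OF U W(1,2)]]
        Wh TH by auto
    then show ?thesis using bij by (intro exI[of _ Y]) (simp add: bij_def surj_f_inv_f)
  qed
  show ?thesis
  proof (intro conjI impI, goal_cases)
    case 1
    from main1[OF this] show ?case using pow by metis
  next
    case 2
    from main2[OF this] show ?case using pow by metis
  next
    case 3
    then have "unitary_on UNIV Qb" "\<forall>h\<in>H. Q (X (T h)) = T (X h)" by blast+
    from main3[OF this] show ?case using pow by metis
  qed
qed

end
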